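(* The interval $[\mathsf{V}_s(S_7),\mathsf{V}_s(B_2^1)]$ in the lattice of semigroup varieties has cardinality $2^{\aleph_0}$.
   Context: For an additively idempotent semiring $S=(S,+,\cdot)$, $\mathsf{V}_s(S)$ denotes the variety of semigroups generated by the multiplicative semigroup reduct $(S,\cdot)$ (signature: one binary operation). For semigroup varieties $\mathcal{W}\subseteq\mathcal{V}$, the interval $[\mathcal{W},\mathcal{V}]$ is the collection of all semigroup varieties $\mathcal{U}$ with $\mathcal{W}\subseteq\mathcal{U}\subseteq\mathcal{V}$. The multiplicative reduct of $S_7$ is the semigroup on $\{0,a,1\}$ in which $0$ is a zero, $1$ is an identity, and $a\cdot a=0$. The multiplicative reduct of $B_2^1$ is the six-element Brandt monoid, consisting of the $2\times 2$ matrices $0=\begin{pmatrix}0&0\\0&0\end{pmatrix}$, $1=\begin{pmatrix}1&0\\0&1\end{pmatrix}$, $a=\begin{pmatrix}0&1\\0&0\end{pmatrix}$, $b=\begin{pmatrix}0&0\\1&0\end{pmatrix}$, $ab=\begin{pmatrix}1&0\\0&0\end{pmatrix}$, $ba=\begin{pmatrix}0&0\\0&1\end{pmatrix}$ under ordinary matrix multiplication. The subset $\{0,a,1\}$ of it is a copy of the multiplicative reduct of $S_7$. *)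

theory Defs
  imports "HOL-Analysis.Cartesian_Space" "HOL-Library.Equipollence"
begin

text \<open>
  A class of semigroups is a set of structures whose carriers are subsets of one type \<open>'u\<close>,
  which plays the role of the universe. Distinct semigroup varieties are already separated by
  countable semigroups (quotients of the free semigroup of countable rank), so any infinite
  universe \<open>'u\<close> sees the whole lattice of semigroup varieties.
\<close>

record 'a magma =
  carrier :: "'a set"
  mult :: "'a \<Rightarrow> 'a \<Rightarrow> 'a"  (infixl "\<cdot>\<index>" 70)

definition is_semigroup :: "'a magma \<Rightarrow> bool" where
  "is_semigroup S \<longleftrightarrow>
     carrier S \<noteq> {} \<and>
     (\<forall>x\<in>carrier S. \<forall>y\<in>carrier S. x \<cdot>\<^bsub>S\<^esub> y \<in> carrier S) \<and>
     (\<forall>x\<in>carrier S. \<forall>y\<in>carrier S. \<forall>z\<in>carrier S.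
        (x \<cdot>\<^bsub>S\<^esub> y) \<cdot>\<^bsub>S\<^esub> z = x \<cdot>\<^bsub>S\<^esub> (y \<cdot>\<^bsub>S\<^esub> z))"

definition isomorphic :: "'a magma \<Rightarrow> 'b magma \<Rightarrow> bool" where
  "isomorphic S T \<longleftrightarrow>
     (\<exists>h. bij_betw h (carrier S) (carrier T) \<and>
          (\<forall>x\<in>carrier S. \<forall>y\<in>carrier S. h (x \<cdot>\<^bsub>S\<^esub> y) = h x \<cdot>\<^bsub>T\<^esub> h y))"

datatype sg_term = Var nat | Mult sg_term sg_term

type_synonym identity = "sg_term \<times> sg_term"

primrec eval_term :: "'a magma \<Rightarrow> (nat \<Rightarrow> 'a) \<Rightarrow> sg_term \<Rightarrow> 'a" where
  "eval_term S \<phi> (Var i) = \<phi> i"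
| "eval_term S \<phi> (Mult s t) = eval_term S \<phi> s \<cdot>\<^bsub>S\<^esub> eval_term S \<phi> t"

definition satisfies :: "'a magma \<Rightarrow> identity \<Rightarrow> bool" where
  "satisfies S e \<longleftrightarrow>
     (\<forall>\<phi>. range \<phi> \<subseteq> carrier S \<longrightarrow> eval_term S \<phi> (fst e) = eval_term S \<phi> (snd e))"

definition semigroup_variety :: "'u magma set \<Rightarrow> bool" where
  "semigroup_variety V \<longleftrightarrow>
     (\<exists>\<Sigma> :: identity set. V = {S. is_semigroup S \<and> (\<forall>e\<in>\<Sigma>. satisfies S e)})"

text \<open>
  The generating semigroup need not live on the universe type \<open>'u\<close>, so ``\<open>V\<close> contains \<open>S\<close>''
  is expressed by \<open>V\<close> containing all isomorphic copies of \<open>S\<close> in the universe. When \<open>S\<close> is finite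
  and \<open>'u\<close> is infinite such copies exist.
\<close>

definition variety_generated_by :: "'a magma \<Rightarrow> 'u magma set" where
  "variety_generated_by S =
     \<Inter> {V. semigroup_variety V \<and> (\<forall>T. isomorphic S T \<longrightarrow> T \<in> V)}"

definition variety_interval :: "'u magma set \<Rightarrow> 'u magma set \<Rightarrow> 'u magma set set" where
  "variety_interval W V = {U. semigroup_variety U \<and> W \<subseteq> U \<and> U \<subseteq> V}"

datatype s7 = S7_zero | S7_a | S7_one

fun s7_times :: "s7 \<Rightarrow> s7 \<Rightarrow> s7" where
  "s7_times S7_one y = y"
| "s7_times x S7_one = x"
| "s7_times _ _ = S7_zero"

definition S7_reduct :: "s7 magma" where
  "S7_reduct = \<lparr>carrier = UNIV, mult = s7_times\<rparr>"

definition mat2 :: "int \<Rightarrow> int \<Rightarrow> int \<Rightarrow> int \<Rightarrow> int ^ 2 ^ 2" where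
  "mat2 p q r s = vector [vector [p, q], vector [r, s]]"

definition B21_reduct :: "(int ^ 2 ^ 2) magma" where
  "B21_reduct =
     \<lparr>carrier = {mat2 0 0 0 0, mat2 1 0 0 1, mat2 0 1 0 0,
                  mat2 0 0 1 0, mat2 1 0 0 0, mat2 0 0 0 1},
      mult = (**)\<rparr>"

end

theory Submission
  imports Defs "HOL-Library.Sublist" "HOL-Library.Countable_Set"
begin

text \<open>
  There are at most continuum many varieties because there are only countably many identities.
  For the lower bound let \<open>w\<^sub>n = x\<^sub>1 \<dots> x\<^sub>n t x\<^sub>n x\<^sub>1 x\<^bsub>n-1\<^esub> \<dots> x\<^sub>2\<close> with \<open>n \<ge> 4\<close>. The identities
  \<open>w\<^sub>n = w\<^sub>n x\<^sub>1\<close> hold in \<open>S\<^sub>7\<close>, so adding any set of them to the identities of \<open>B\<^sub>2\<^sup>1\<close> defines a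
  variety in the interval. They are independent modulo the identities of \<open>B\<^sub>2\<^sup>1\<close>: the Rees quotient
  of the free semigroup whose nonzero elements are the factors of \<open>w\<^sub>m\<close> satisfies all identities of
  \<open>B\<^sub>2\<^sup>1\<close>, since \<open>w\<^sub>m\<close> is an isoterm for \<open>B\<^sub>2\<^sup>1\<close>, and it satisfies \<open>w\<^sub>n = w\<^sub>n x\<^sub>1\<close> exactly for
  \<open>n \<noteq> m\<close>, since no substitution of nonempty words turns \<open>w\<^sub>n\<close> into a factor of \<open>w\<^sub>m\<close> for
  \<open>n \<noteq> m\<close>.
\<close>

section \<open>Varieties and isomorphic copies\<close>

definition models :: "identity set \<Rightarrow> 'u magma set" where
  "models \<Sigma> = {S. is_semigroup S \<and> (\<forall>e\<in>\<Sigma>. satisfies S e)}"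

definition identities :: "'a magma \<Rightarrow> identity set" where
  "identities S = {e. satisfies S e}"

lemma eval_term_closed:
  assumes "is_semigroup S" "range \<phi> \<subseteq> carrier S"
  shows "eval_term S \<phi> s \<in> carrier S"
  using assms by (induction s) (auto simp: is_semigroup_def)

lemma eval_term_hom:
  fixes S :: "'a magma" and T :: "'b magma"
  assumes "is_semigroup S" "range \<phi> \<subseteq> carrier S"
    and "\<And>x y. x \<in> carrier S \<Longrightarrow> y \<in> carrier S \<Longrightarrow> h (x \<cdot>\<^bsub>S\<^esub> y) = h x \<cdot>\<^bsub>T\<^esub> h y"
  shows "eval_term T (h \<circ> \<phi>) s = h (eval_term S \<phi> s)"
  by (induction s) (simp_all add: assms eval_term_closed)

text \<open>Evaluation commutes with \<open>h\<close>, and injectivity reflects the resulting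
  equality. Besides isomorphic copies this serves the embedding of \<open>S7_reduct\<close> into
  \<open>B21_reduct\<close>.\<close>

lemma satisfies_embedding:
  assumes S: "is_semigroup S" and inj: "inj_on h (carrier S)" and sub: "h ` carrier S \<subseteq> carrier T"
    and hom: "\<And>x y. x \<in> carrier S \<Longrightarrow> y \<in> carrier S \<Longrightarrow> h (x \<cdot>\<^bsub>S\<^esub> y) = h x \<cdot>\<^bsub>T\<^esub> h y"
    and T: "satisfies T e"
  shows "satisfies S e"
  unfolding satisfies_def
proof (intro allI impI)
  fix \<phi> :: "nat \<Rightarrow> _" assume \<phi>: "range \<phi> \<subseteq> carrier S"
  have "range (h \<circ> \<phi>) \<subseteq> carrier T" using \<phi> sub by auto
  then have "eval_term T (h \<circ> \<phi>) (fst e) = eval_term T (h \<circ> \<phi>) (snd e)"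
    using T unfolding satisfies_def by blast
  then have "h (eval_term S \<phi> (fst e)) = h (eval_term S \<phi> (snd e))"
    by (simp only: eval_term_hom[where h = h, OF S \<phi> hom])
  then show "eval_term S \<phi> (fst e) = eval_term S \<phi> (snd e)"
    using inj eval_term_closed[OF S \<phi>] by (auto dest: inj_onD)
qed

lemma isomorphic_sym:
  assumes "is_semigroup S" "isomorphic S T"
  shows "isomorphic T S"
proof -
  obtain h where h: "bij_betw h (carrier S) (carrier T)"
    and hom: "\<And>x y. x \<in> carrier S \<Longrightarrow> y \<in> carrier S \<Longrightarrow> h (x \<cdot>\<^bsub>S\<^esub> y) = h x \<cdot>\<^bsub>T\<^esub> h y"
    using assms(2) unfolding isomorphic_def by blast
  let ?g = "inv_into (carrier S) h"
  have "?g (x \<cdot>\<^bsub>T\<^esub> y) = ?g x \<cdot>\<^bsub>S\<^esub> ?g y" if "x \<in> carrier T" "y \<in> carrier T" for x y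
  proof -
    obtain a b where ab: "a \<in> carrier S" "b \<in> carrier S" "x = h a" "y = h b"
      using \<open>x \<in> carrier T\<close> \<open>y \<in> carrier T\<close> h unfolding bij_betw_def by blast
    then have "a \<cdot>\<^bsub>S\<^esub> b \<in> carrier S" using assms(1) by (simp add: is_semigroup_def)
    then show ?thesis using ab hom h by (metis bij_betw_inv_into_left)
  qed
  then show ?thesis unfolding isomorphic_def using bij_betw_inv_into[OF h] by blast
qed

lemma isomorphic_is_semigroup:
  assumes "is_semigroup S" "isomorphic S T"
  shows "is_semigroup T"
proof -
  obtain h where h: "carrier T = h ` carrier S"
    and hom: "\<And>x y. x \<in> carrier S \<Longrightarrow> y \<in> carrier S \<Longrightarrow> h x \<cdot>\<^bsub>T\<^esub> h y = h (x \<cdot>\<^bsub>S\<^esub> y)"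
    using assms(2) unfolding isomorphic_def bij_betw_def by metis
  show ?thesis using assms(1) by (simp add: is_semigroup_def h hom)
qed

lemma isomorphic_satisfies:
  assumes S: "is_semigroup S" and iso: "isomorphic S T" and sat: "satisfies T e"
  shows "satisfies S e"
proof -
  obtain h where "bij_betw h (carrier S) (carrier T)"
    and "\<forall>x\<in>carrier S. \<forall>y\<in>carrier S. h (x \<cdot>\<^bsub>S\<^esub> y) = h x \<cdot>\<^bsub>T\<^esub> h y"
    using iso unfolding isomorphic_def by blast
  then show ?thesis
    using S sat by (intro satisfies_embedding[of S h T]) (auto simp: bij_betw_def)
qed

lemma isomorphic_satisfies_iff:
  assumes S: "is_semigroup S" and iso: "isomorphic S T"
  shows "satisfies S e \<longleftrightarrow> satisfies T e"
  using isomorphic_satisfies[OF S iso]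
    isomorphic_satisfies[OF isomorphic_is_semigroup[OF S iso] isomorphic_sym[OF S iso]] by blast

lemma isomorphic_copy_exists:
  fixes S :: "'a magma"
  assumes "infinite (UNIV :: 'u set)" "countable (carrier S)"
  obtains T :: "'u magma" where "isomorphic S T"
proof -
  obtain g :: "nat \<Rightarrow> 'u" where g: "inj g"
    using assms(1) infinite_countable_subset by blast
  define h where "h = g \<circ> to_nat_on (carrier S)"
  have h: "inj_on h (carrier S)"
    unfolding h_def using assms(2) g by (intro comp_inj_on) (auto intro: inj_on_subset)
  let ?k = "inv_into (carrier S) h"
  have "isomorphic S \<lparr>carrier = h ` carrier S, mult = \<lambda>x y. h (?k x \<cdot>\<^bsub>S\<^esub> ?k y)\<rparr>"
    unfolding isomorphic_def using h by (intro exI[of _ h]) (simp add: bij_betw_def)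
  then show ?thesis using that by blast
qed

text \<open>The models of the identities of \<open>S\<close> form a variety containing every copy of
  \<open>S\<close>. The converse inclusion needs an actual copy \<open>T\<close> in the universe: it
  lies in every competing variety, so the defining identities of that variety hold in
  \<open>S\<close>.\<close>

lemma variety_generated_by_eq_models:
  fixes S :: "'a magma"
  assumes inf: "infinite (UNIV :: 'u set)" and S: "is_semigroup S" and "countable (carrier S)"
  shows "(variety_generated_by S :: 'u magma set) = models (identities S)"
proof
  have "semigroup_variety (models (identities S) :: 'u magma set)"
    unfolding semigroup_variety_def models_def by blast
  moreover have "T \<in> models (identities S)" if "isomorphic S T" for T :: "'u magma"
    using isomorphic_is_semigroup[OF S that] isomorphic_satisfies_iff[OF S that]
    by (simp add: models_def identities_def)
  ultimately show "(variety_generated_by S :: 'u magma set) \<subseteq> models (identities S)"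
    unfolding variety_generated_by_def by blast
  obtain T :: "'u magma" where T: "isomorphic S T"
    using isomorphic_copy_exists[OF inf assms(3)] .
  show "models (identities S) \<subseteq> (variety_generated_by S :: 'u magma set)"
    unfolding variety_generated_by_def
  proof (rule Inter_greatest)
    fix V :: "'u magma set"
    assume "V \<in> {V. semigroup_variety V \<and> (\<forall>T. isomorphic S T \<longrightarrow> T \<in> V)}"
    then obtain \<Sigma> where V: "V = models \<Sigma>" and "T \<in> V"
      using T unfolding semigroup_variety_def models_def by blast
    then have "\<Sigma> \<subseteq> identities S"
      using isomorphic_satisfies_iff[OF S T] by (auto simp: models_def identities_def)
    then show "models (identities S) \<subseteq> V" unfolding V models_def by blast
  qed
qed

instance sg_term :: countable
  by countable_datatype

lemma semigroup_varieties_lepoll: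
  "{V :: 'u magma set. semigroup_variety V} \<lesssim> (UNIV :: nat set set)"
proof -
  have "{V :: 'u magma set. semigroup_variety V} = range models"
    unfolding semigroup_variety_def models_def by blast
  also have "\<dots> \<lesssim> (UNIV :: identity set set)" by (rule image_lepoll)
  also have "\<dots> \<lesssim> (UNIV :: nat set set)"
    \<comment> \<open>Terms are countable, so \<open>to_nat\<close> codes sets of identities
      injectively as sets of naturals.\<close>
    unfolding lepoll_def by (intro exI[of _ "image to_nat"]) (simp add: inj_image_eq_iff inj_def)
  finally show ?thesis .
qed

section \<open>Words\<close>

primrec flat :: "sg_term \<Rightarrow> nat list" where
  "flat (Var i) = [i]"
| "flat (Mult s t) = flat s @ flat t"

text \<open>Any bracketing would do in a semigroup. Terms denote nonempty words only, hence the
  placeholder at \<open>[]\<close>.\<close>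

fun word_term :: "nat list \<Rightarrow> sg_term" where
  "word_term [] = undefined"
| "word_term [x] = Var x"
| "word_term (x # y # xs) = Mult (Var x) (word_term (y # xs))"

lemma flat_nonempty [simp]: "flat s \<noteq> []"
  by (induction s) auto

lemma flat_word_term [simp]: "w \<noteq> [] \<Longrightarrow> flat (word_term w) = w"
  by (induction w rule: word_term.induct) auto

text \<open>Projecting both words onto the pair of their first letters shows that these letters
  agree, so they cancel. Pairs with \<open>x = y\<close> exclude that one word ends earlier.\<close>

lemma eq_if_filter_pairs_eq:
  assumes "\<And>x y. filter (\<lambda>z. z = x \<or> z = y) u = filter (\<lambda>z. z = x \<or> z = y) v"
  shows "u = v"
  using assms
proof (induction u arbitrary: v)
  case Nil
  show ?case
  proof (cases v)
    case (Cons b v')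
    with Nil[of b b] show ?thesis by simp
  qed simp
next
  case (Cons a u)
  show ?case
  proof (cases v)
    case Nil
    with Cons.prems[of a a] show ?thesis by simp
  next
    case v: (Cons b v')
    have ab: "a = b" using Cons.prems[of a b] v by simp
    have "filter (\<lambda>z. z = x \<or> z = y) u = filter (\<lambda>z. z = x \<or> z = y) v'" for x y
      using Cons.prems[of x y] v ab by (simp split: if_splits)
    then show ?thesis using Cons.IH v ab by blast
  qed
qed

lemma filter_pair_distinct:
  assumes "distinct A" "x \<in> set A" "y \<in> set A" "x \<noteq> y"
  shows "filter (\<lambda>z. z = x \<or> z = y) A = [x, y] \<or> filter (\<lambda>z. z = x \<or> z = y) A = [y, x]"
proof -
  let ?B = "filter (\<lambda>z. z = x \<or> z = y) A"
  have d: "distinct ?B" and s: "set ?B = {x, y}" using assms by auto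
  then have "length ?B = 2" using assms(4) distinct_card[of ?B] by simp
  then obtain p q where "?B = [p, q]" by (auto simp: length_Suc_conv numeral_2_eq_2)
  with d s show ?thesis by (auto simp: doubleton_eq_iff)
qed

lemma filter_eq_replicate: "filter (\<lambda>z. z = x) u = replicate (count_list u x) x"
  by (induction u) auto

section \<open>The Brandt monoid\<close>

lemma mat2_mult [simp]:
  "mat2 p q r s ** mat2 p' q' r' s' =
     mat2 (p * p' + q * r') (p * q' + q * s') (r * p' + s * r') (r * q' + s * s')"
  by (simp add: mat2_def vec_eq_iff matrix_matrix_mult_def forall_2 sum_2 vector_2)

lemma mat2_eq_iff [simp]:
  "mat2 p q r s = mat2 p' q' r' s' \<longleftrightarrow> p = p' \<and> q = q' \<and> r = r' \<and> s = s'"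
  by (auto simp: mat2_def vec_eq_iff forall_2 vector_2)

lemma mat_1_eq_mat2: "(mat 1 :: int ^ 2 ^ 2) = mat2 1 0 0 1"
  by (simp add: mat2_def vec_eq_iff mat_def forall_2 vector_2)

abbreviation B21 :: "(int ^ 2 ^ 2) set" where
  "B21 \<equiv> carrier B21_reduct"

lemma B21_mult [simp]: "x \<cdot>\<^bsub>B21_reduct\<^esub> y = x ** y"
  by (simp add: B21_reduct_def)

lemma B21_units [simp]:
  "mat2 0 0 0 0 \<in> B21" "mat2 1 0 0 1 \<in> B21" "mat2 0 1 0 0 \<in> B21"
  "mat2 0 0 1 0 \<in> B21" "mat2 1 0 0 0 \<in> B21" "mat2 0 0 0 1 \<in> B21"
  by (simp_all add: B21_reduct_def)

lemma B21_mult_closed: "x \<in> B21 \<Longrightarrow> y \<in> B21 \<Longrightarrow> x ** y \<in> B21"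
  by (auto simp: B21_reduct_def)

lemma is_semigroup_B21: "is_semigroup B21_reduct"
proof -
  have "B21 \<noteq> {}" using B21_units(1) by blast
  then show ?thesis by (simp add: is_semigroup_def B21_mult_closed matrix_mul_assoc)
qed

definition weval :: "(nat \<Rightarrow> int ^ 2 ^ 2) \<Rightarrow> nat list \<Rightarrow> int ^ 2 ^ 2" where
  "weval \<phi> w = foldr (\<lambda>x A. \<phi> x ** A) w (mat2 1 0 0 1)"

lemma weval_Nil [simp]: "weval \<phi> [] = mat2 1 0 0 1"
  and weval_Cons [simp]: "weval \<phi> (x # w) = \<phi> x ** weval \<phi> w"
  by (simp_all add: weval_def)

lemma mat2_one_mult [simp]: "mat2 1 0 0 1 ** A = A" "A ** mat2 1 0 0 1 = A"
  by (simp_all flip: mat_1_eq_mat2)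

lemma weval_append [simp]: "weval \<phi> (u @ v) = weval \<phi> u ** weval \<phi> v"
  by (induction u) (simp_all add: matrix_mul_assoc)

lemma weval_closed: "range \<phi> \<subseteq> B21 \<Longrightarrow> weval \<phi> w \<in> B21"
  by (induction w) (auto intro: B21_mult_closed)

text \<open>Sending letters to the identity matrix deletes them, so identities of the Brandt monoid
  can be tested on a few letters at a time.\<close>

lemma weval_filter: "(\<And>x. \<not> P x \<Longrightarrow> \<phi> x = mat2 1 0 0 1) \<Longrightarrow> weval \<phi> (filter P w) = weval \<phi> w"
  by (induction w) simp_all

lemma eval_term_B21: "eval_term B21_reduct \<phi> s = weval \<phi> (flat s)"
  by (induction s) simp_all

lemma weval_concat_map: "weval \<phi> (concat (map \<theta> w)) = weval (\<lambda>x. weval \<phi> (\<theta> x)) w"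
  by (induction w) simp_all

definition B21_equiv :: "nat list \<Rightarrow> nat list \<Rightarrow> bool" where
  "B21_equiv u v \<longleftrightarrow> (\<forall>\<phi>. range \<phi> \<subseteq> B21 \<longrightarrow> weval \<phi> u = weval \<phi> v)"

definition isoterm :: "nat list \<Rightarrow> bool" where
  "isoterm w \<longleftrightarrow> (\<forall>v. B21_equiv w v \<longrightarrow> v = w)"

lemma satisfies_B21_iff: "satisfies B21_reduct e \<longleftrightarrow> B21_equiv (flat (fst e)) (flat (snd e))"
  by (simp add: satisfies_def B21_equiv_def eval_term_B21)

lemma B21_equiv_sym: "B21_equiv u v \<Longrightarrow> B21_equiv v u"
  by (simp add: B21_equiv_def)

lemma B21_equivD: "B21_equiv u v \<Longrightarrow> (\<And>x. \<phi> x \<in> B21) \<Longrightarrow> weval \<phi> u = weval \<phi> v"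
  by (simp add: B21_equiv_def image_subset_iff)

lemma B21_equiv_subst:
  assumes "B21_equiv u v"
  shows "B21_equiv (c @ concat (map \<theta> u) @ d) (c @ concat (map \<theta> v) @ d)"
  unfolding B21_equiv_def
proof (intro allI impI)
  fix \<phi> :: "nat \<Rightarrow> int ^ 2 ^ 2" assume "range \<phi> \<subseteq> B21"
  then have "weval \<phi> (\<theta> x) \<in> B21" for x by (rule weval_closed)
  from B21_equivD[OF assms this]
  show "weval \<phi> (c @ concat (map \<theta> u) @ d) = weval \<phi> (c @ concat (map \<theta> v) @ d)"
    by (simp add: weval_concat_map)
qed

section \<open>Content and single occurrences of letters\<close>

lemma weval_kill_iff:
  "weval (\<lambda>z. if z = x then mat2 0 0 0 0 else mat2 1 0 0 1) w =
     (if x \<in> set w then mat2 0 0 0 0 else mat2 1 0 0 1)"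
  by (induction w) auto

lemma B21_equiv_set:
  assumes "B21_equiv u v"
  shows "set u = set v"
proof -
  have "x \<in> set u \<longleftrightarrow> x \<in> set v" for x
  proof -
    have "weval (\<lambda>z. if z = x then mat2 0 0 0 0 else mat2 1 0 0 1) u =
          weval (\<lambda>z. if z = x then mat2 0 0 0 0 else mat2 1 0 0 1) v"
      by (intro B21_equivD[OF assms]) simp
    then show ?thesis by (simp add: weval_kill_iff split: if_splits)
  qed
  then show ?thesis by blast
qed

text \<open>A nonzero matrix with square zero distinguishes no occurrence, one occurrence and
  several occurrences of \<open>x\<close>.\<close>

lemma weval_nilpotent:
  "weval (\<lambda>z. if z = x then mat2 0 1 0 0 else mat2 1 0 0 1) w =
     (if count_list w x = 0 then mat2 1 0 0 1
      else if count_list w x = 1 then mat2 0 1 0 0 else mat2 0 0 0 0)"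
  by (induction w) auto

lemma B21_equiv_count_1:
  assumes "B21_equiv u v" "count_list u x = 1"
  shows "count_list v x = 1"
proof -
  have "weval (\<lambda>z. if z = x then mat2 0 1 0 0 else mat2 1 0 0 1) u =
        weval (\<lambda>z. if z = x then mat2 0 1 0 0 else mat2 1 0 0 1) v"
    by (intro B21_equivD[OF assms(1)]) simp
  then show ?thesis using assms(2) by (simp add: weval_nilpotent split: if_splits)
qed

lemma split_list_count_1:
  assumes "count_list v t = 1"
  obtains p q where "v = p @ t # q" "t \<notin> set p" "t \<notin> set q"
proof -
  have "t \<in> set v" using assms by (metis count_list_0_iff zero_neq_one)
  then obtain p q where v: "v = p @ t # q" "t \<notin> set p" by (meson split_list_first)
  then have "count_list q t = 0" using assms by simp
  then show ?thesis using v that by (simp add: count_list_0_iff)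
qed

lemma count_list_distinct: "distinct A \<Longrightarrow> count_list A x = (if x \<in> set A then 1 else 0)"
  by (induction A) auto

lemma distinct_if_count_list:
  "(\<And>x. x \<in> set A \<Longrightarrow> count_list A x = 1) \<Longrightarrow> distinct A"
proof (induction A)
  case (Cons a A)
  have "a \<notin> set A" using Cons.prems[of a] by (simp add: count_list_0_iff)
  moreover have "distinct A"
    using Cons.prems \<open>a \<notin> set A\<close> by (intro Cons.IH) (metis count_list.simps(2) list.set_intros(2))
  ultimately show ?case by simp
qed simp

text \<open>
  An assignment of matrix units reads a word as a walk on two vertices. With
  \<open>x\<close> and \<open>y\<close> the two arrows between the vertices, \<open>t\<close> can be chosen to connect
  the walk through the first block to the walk through the second one; exchanging \<open>x\<close> and \<open>y\<close> in
  either block then breaks the walk at \<open>t\<close>.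
\<close>

lemma isoterm_two_blocks_order:
  assumes equiv: "B21_equiv (A @ t # B) (p @ t # q)"
    and "distinct A" "distinct B" "distinct p" "distinct q"
    and "set B = set A" "set p = set A" "set q = set A" "t \<notin> set A"
    and A: "filter (\<lambda>z. z = x \<or> z = y) A = [x, y]" and "x \<noteq> y"
  shows "filter (\<lambda>z. z = x \<or> z = y) p = filter (\<lambda>z. z = x \<or> z = y) A \<and>
         filter (\<lambda>z. z = x \<or> z = y) q = filter (\<lambda>z. z = x \<or> z = y) B"
proof -
  let ?f = "filter (\<lambda>z. z = x \<or> z = y)"
  let ?P = "\<lambda>z. z = x \<or> z = y \<or> z = t"
  have xy: "x \<in> set A" "y \<in> set A" using arg_cong[OF A, of set] by auto
  then have tn: "t \<noteq> x" "t \<noteq> y" using \<open>t \<notin> set A\<close> by auto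
  have f: "filter ?P C = ?f C" if "set C = set A" for C
  proof -
    have "t \<notin> set C" using that \<open>t \<notin> set A\<close> by simp
    then show ?thesis by (intro filter_cong) auto
  qed
  have red: "weval \<phi> (?f A @ t # ?f B) = weval \<phi> (?f p @ t # ?f q)"
    if "\<And>z. \<phi> z \<in> B21" "\<And>z. \<not> ?P z \<Longrightarrow> \<phi> z = mat2 1 0 0 1" for \<phi>
  proof -
    have "weval \<phi> (filter ?P C) = weval \<phi> C" for C by (rule weval_filter) (rule that(2))
    then have "weval \<phi> (filter ?P (A @ t # B)) = weval \<phi> (filter ?P (p @ t # q))"
      using B21_equivD[OF equiv that(1)] by presburger
    then show ?thesis by (simp add: f assms(6-8))
  qed
  define \<phi> where "\<phi> T z = (if z = x then mat2 0 1 0 0 else if z = y then mat2 0 0 1 0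
      else if z = t then T else mat2 1 0 0 1)" for T z
  have \<phi>: "\<phi> T x = mat2 0 1 0 0" "\<phi> T y = mat2 0 0 1 0" "\<phi> T t = T" for T
    using tn \<open>x \<noteq> y\<close> by (auto simp: \<phi>_def)
  have red': "weval (\<phi> T) (?f A @ t # ?f B) = weval (\<phi> T) (?f p @ t # ?f q)" if "T \<in> B21" for T
    using that by (intro red) (auto simp: \<phi>_def)
  \<comment> \<open>Reading \<open>x\<close> and then \<open>y\<close> is a loop at vertex 1. If
    \<open>B\<close> reads \<open>x\<close>, \<open>y\<close>, the walk continues through a loop
    \<open>T\<close> at vertex 1; if \<open>B\<close> reads \<open>y\<close>, \<open>x\<close>,
    through an arrow \<open>T\<close> from 1 to 2. So one of the two equations has a nonzero left
    side, which fixes both orders on the right.\<close>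
  note e = red'[of "mat2 1 0 0 0"] red'[of "mat2 0 1 0 0"]
  have "?f B = [x, y] \<or> ?f B = [y, x]" "?f p = [x, y] \<or> ?f p = [y, x]"
    "?f q = [x, y] \<or> ?f q = [y, x]"
    using filter_pair_distinct[of B x y] filter_pair_distinct[of p x y]
      filter_pair_distinct[of q x y] xy assms(3-8) \<open>x \<noteq> y\<close> by blast+
  then show ?thesis using e A \<open>x \<noteq> y\<close> by (elim disjE) (simp_all add: \<phi>)
qed

text \<open>Here \<open>x\<close> is the arrow from vertex 1 to 2 and the middle factor the arrow
  back. Arrows must alternate along a nonzero walk, and a walk from 1 to 2 that uses the middle
  arrow once has exactly one \<open>x\<close> on each side.\<close>

lemma weval_block_powers:
  assumes "weval \<phi> (replicate i x) ** (mat2 0 0 1 0 ** weval \<phi> (replicate j x)) = mat2 0 1 0 0"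
    and "\<phi> x = mat2 0 1 0 0"
  shows "i = 1 \<and> j = 1"
proof -
  have r: "weval \<phi> (replicate k x) = (if k = 0 then mat2 1 0 0 1 else if k = 1 then mat2 0 1 0 0
      else mat2 0 0 0 0)" for k
    using assms(2) by (induction k) auto
  show ?thesis using assms(1) unfolding r by (auto split: if_splits)
qed

text \<open>The single occurrence of \<open>t\<close> splits \<open>v\<close> into two blocks.
  Opposite arrows for \<open>x\<close> and \<open>t\<close> show that each letter of
  \<open>A\<close> occurs once in each block, and then the order of every pair of letters determines
  the blocks.\<close>

lemma isoterm_two_blocks:
  assumes "distinct A" "distinct B" "set B = set A" "t \<notin> set A"
  shows "isoterm (A @ t # B)"
  unfolding isoterm_def
proof (intro allI impI)
  fix v assume equiv: "B21_equiv (A @ t # B) v"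
  have "count_list (A @ t # B) t = 1" using assms by (simp add: count_list_0_iff)
  from B21_equiv_count_1[OF equiv this] obtain p q
    where v: "v = p @ t # q" and t: "t \<notin> set p" "t \<notin> set q" by (rule split_list_count_1)
  have count: "count_list p x = 1 \<and> count_list q x = 1" if x: "x \<in> set A" for x
  proof -
    let ?P = "\<lambda>z. z = x \<or> z = t"
    define \<phi> where "\<phi> z = (if z = x then mat2 0 1 0 0 else if z = t then mat2 0 0 1 0
        else mat2 1 0 0 1)" for z
    have "x \<noteq> t" using x assms by auto
    have f: "filter ?P C = replicate (count_list C x) x" if "t \<notin> set C" for C
      unfolding filter_eq_replicate[symmetric] using that by (intro filter_cong) auto
    have "weval \<phi> (filter ?P (A @ t # B)) = weval \<phi> (filter ?P v)"
      using B21_equivD[OF equiv, of \<phi>] weval_filter[of ?P \<phi>] by (simp add: \<phi>_def)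
    then have "weval \<phi> (replicate (count_list p x) x) **
        (mat2 0 0 1 0 ** weval \<phi> (replicate (count_list q x) x)) = mat2 0 1 0 0"
      using assms t x \<open>x \<noteq> t\<close> by (simp add: v f count_list_distinct) (simp add: \<phi>_def)
    then show ?thesis by (rule weval_block_powers) (simp add: \<phi>_def)
  qed
  have "insert t (set p \<union> set q) = insert t (set A)"
    using B21_equiv_set[OF equiv] assms by (auto simp: v)
  then have "set p \<union> set q = set A" using t assms(4) by (simp add: insert_ident)
  moreover have "set A \<subseteq> set p" "set A \<subseteq> set q"
    using count by (metis count_list_0_iff subsetI zero_neq_one)+
  ultimately have sets: "set p = set A" "set q = set A" by auto
  have dist: "distinct p" "distinct q"
    using sets count by (auto intro: distinct_if_count_list)
  note order = isoterm_two_blocks_order[OF equiv[unfolded v] assms(1,2) dist assms(3) sets assms(4)]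
  have "filter (\<lambda>z. z = x \<or> z = y) p = filter (\<lambda>z. z = x \<or> z = y) A \<and>
        filter (\<lambda>z. z = x \<or> z = y) q = filter (\<lambda>z. z = x \<or> z = y) B" for x y
  proof -
    have single: "filter (\<lambda>z. z = a) C = (if a \<in> set C then [a] else [])" if "distinct C" for C a
      using that by (simp add: filter_eq_replicate count_list_distinct)
    have drop: "filter (\<lambda>z. z = x \<or> z = y) C = filter (\<lambda>z. z = y) C"
      if "x = y \<or> x \<notin> set C" for C
      using that by (intro filter_cong) auto
    have drop': "filter (\<lambda>z. z = x \<or> z = y) C = filter (\<lambda>z. z = x) C"
      if "y \<notin> set C" for C
      using that by (intro filter_cong) auto
    show ?thesis
    proof (cases "x = y \<or> x \<notin> set A \<or> y \<notin> set A")
      case True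
      then consider "x = y \<or> x \<notin> set A" | "y \<notin> set A" by blast
      then show ?thesis
        by cases (use assms sets dist in \<open>simp_all add: drop drop' single\<close>)
    next
      case False
      then consider "filter (\<lambda>z. z = x \<or> z = y) A = [x, y]" | "filter (\<lambda>z. z = x \<or> z = y) A = [y, x]"
        using filter_pair_distinct[OF assms(1)] by metis
      then show ?thesis
      proof cases
        case 1
        then show ?thesis using order[of x y] False by blast
      next
        case 2
        \<comment> \<open>\<open>order\<close> expects the first letter of the pair to come first in
          \<open>A\<close>, so \<open>x\<close> and \<open>y\<close> swap roles here.\<close>
        then have "filter (\<lambda>z. z = y \<or> z = x) A = [y, x]" by (simp add: disj_commute)
        then have "filter (\<lambda>z. z = y \<or> z = x) p = filter (\<lambda>z. z = y \<or> z = x) A \<and>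
            filter (\<lambda>z. z = y \<or> z = x) q = filter (\<lambda>z. z = y \<or> z = x) B"
          using order[of y x] False by blast
        then show ?thesis by (simp add: disj_commute)
      qed
    qed
  qed
  then have "p = A" "q = B" by (blast intro: eq_if_filter_pairs_eq)+
  then show "v = A @ t # B" using v by simp
qed

section \<open>Rees quotients of free semigroups\<close>

text \<open>The nonempty factors of \<open>w\<close>, with the empty list in the role of the zero element.\<close>

definition factor_semigroup :: "'a list \<Rightarrow> 'a list magma" where
  "factor_semigroup w = \<lparr>carrier = {u. sublist u w},
     mult = \<lambda>u v. if u \<noteq> [] \<and> v \<noteq> [] \<and> sublist (u @ v) w then u @ v else []\<rparr>"

lemma sublist_appendD:
  assumes "sublist (u @ v) w"
  shows "sublist u w" "sublist v w"
  using assms sublist_order.order_trans by blast+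

lemma carrier_factor_semigroup [simp]: "carrier (factor_semigroup w) = {u. sublist u w}"
  by (simp add: factor_semigroup_def)

lemma mult_factor_semigroup [simp]:
  "u \<cdot>\<^bsub>factor_semigroup w\<^esub> v = (if u \<noteq> [] \<and> v \<noteq> [] \<and> sublist (u @ v) w then u @ v else [])"
  by (simp add: factor_semigroup_def)

lemma is_semigroup_factor_semigroup: "is_semigroup (factor_semigroup w)"
proof -
  let ?F = "factor_semigroup w"
  have "(u \<cdot>\<^bsub>?F\<^esub> v) \<cdot>\<^bsub>?F\<^esub> z = u \<cdot>\<^bsub>?F\<^esub> (v \<cdot>\<^bsub>?F\<^esub> z)" for u v z
    using sublist_appendD[of "u @ v" z w] sublist_appendD[of u "v @ z" w] by auto
  moreover have "carrier ?F \<noteq> {}" using sublist_Nil_left[of w] by auto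
  moreover have "u \<cdot>\<^bsub>?F\<^esub> v \<in> carrier ?F" for u v by simp
  ultimately show ?thesis unfolding is_semigroup_def by blast
qed

text \<open>Factors of factors of \<open>w\<close> are factors, so no partial product vanishes when
  the full product is a factor. Letters sent to \<open>[]\<close> need a separate condition:
  concatenation would drop them, whereas \<open>[]\<close> is the zero.\<close>

lemma eval_term_factor_semigroup:
  assumes "range \<theta> \<subseteq> carrier (factor_semigroup w)"
  shows "eval_term (factor_semigroup w) \<theta> s =
    (if (\<forall>x\<in>set (flat s). \<theta> x \<noteq> []) \<and> sublist (concat (map \<theta> (flat s))) w
     then concat (map \<theta> (flat s)) else [])"
proof (induction s)
  case (Var x)
  then show ?case using assms by (auto simp: factor_semigroup_def)
next
  case (Mult s r)
  have ne: "concat (map \<theta> (flat s)) \<noteq> []" if "\<forall>x\<in>set (flat s). \<theta> x \<noteq> []" for s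
    using that flat_nonempty[of s] by (cases "flat s") auto
  show ?case
    unfolding eval_term.simps Mult.IH
    using ne[of s] ne[of r]
      sublist_appendD[of "concat (map \<theta> (flat s))" "concat (map \<theta> (flat r))" w]
    by (auto simp: factor_semigroup_def)
qed

text \<open>If one side takes a nonzero value, that value sits inside \<open>w\<close>. Replacing it
  there by the image of the other side gives a word equivalent to \<open>w\<close>, hence
  \<open>w\<close> itself, and the context cancels. Equality of contents makes the test for zero
  letters the same on both sides.\<close>

lemma factor_semigroup_satisfies_B21_identities:
  assumes iso: "isoterm w" and sat: "satisfies B21_reduct e"
  shows "satisfies (factor_semigroup w) e"
  unfolding satisfies_def
proof (intro allI impI)
  fix \<theta> :: "nat \<Rightarrow> nat list"
  assume \<theta>: "range \<theta> \<subseteq> carrier (factor_semigroup w)"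
  let ?W = "\<lambda>s. concat (map \<theta> (flat s))"
  have *: "?W s = ?W r" if equiv: "B21_equiv (flat s) (flat r)" and sub: "sublist (?W s) w" for s r
  proof -
    obtain c d where w: "w = c @ ?W s @ d"
      using sub unfolding sublist_def by blast
    then have "c @ ?W r @ d = w"
      using iso B21_equiv_subst[OF equiv, of c \<theta> d] unfolding isoterm_def by metis
    with w have "c @ ?W s @ d = c @ ?W r @ d" by simp
    then show ?thesis by simp
  qed
  obtain s r where e: "e = (s, r)" by fastforce
  have equiv: "B21_equiv (flat s) (flat r)" using sat by (simp add: satisfies_B21_iff e)
  show "eval_term (factor_semigroup w) \<theta> (fst e) = eval_term (factor_semigroup w) \<theta> (snd e)"
    unfolding e fst_conv snd_conv eval_term_factor_semigroup[OF \<theta>]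
    using *[OF equiv] *[OF B21_equiv_sym[OF equiv]] B21_equiv_set[OF equiv] by metis
qed

section \<open>An antichain of isoterms\<close>

text \<open>For \<open>4 \<le> m\<close> no letter is directly followed by its successor, in
  contrast to the increasing first block of \<open>chain_word\<close>; the pair \<open>m\<close>,
  \<open>1\<close> records the length.\<close>

definition block :: "nat \<Rightarrow> nat list" where
  "block m = m # 1 # rev [2..<m]"

definition chain_word :: "nat \<Rightarrow> nat list" where
  "chain_word m = [1..<Suc m] @ 0 # block m"

definition chain_identity :: "nat \<Rightarrow> identity" where
  "chain_identity m = (word_term (chain_word m), word_term (chain_word m @ [1]))"

lemma set_block: "2 \<le> m \<Longrightarrow> set (block m) = set [1..<Suc m]"
  by (auto simp: block_def)

lemma distinct_block: "2 \<le> m \<Longrightarrow> distinct (block m)"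
  by (auto simp: block_def)

lemma isoterm_chain_word: "2 \<le> m \<Longrightarrow> isoterm (chain_word m)"
  unfolding chain_word_def
  by (intro isoterm_two_blocks) (auto simp del: upt_Suc simp: set_block distinct_block)

lemma sublist_upt:
  assumes "sublist (x # y # zs) [i..<j]"
  shows "y = Suc x"
proof -
  obtain ps ss where u: "[i..<j] = ps @ (x # y # zs) @ ss"
    using assms unfolding sublist_def by blast
  have len: "Suc (length ps) < j - i"
    using arg_cong[OF u, of length] by simp
  have "[i..<j] ! length ps = x" "[i..<j] ! Suc (length ps) = y"
    by (simp_all add: u nth_append)
  then show ?thesis using len by simp
qed

text \<open>The only ascent is from \<open>1\<close> to \<open>m - 1\<close>, which is a step of at
  least two because \<open>4 \<le> m\<close>.\<close>

lemma sublist_block: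
  assumes "4 \<le> m" "sublist [x, y] (block m)"
  shows "x = m \<and> y = 1 \<or> x = 1 \<and> y = m - 1 \<or> x = Suc y"
proof -
  have r: "rev [2..<m] = (m - 1) # rev [2..<m - 1]"
    using assms(1) upt_Suc_append[of 2 "m - 1"] by simp
  from assms(2) consider "x = m \<and> y = 1" | "x = 1 \<and> y = m - 1" | "sublist [x, y] (rev [2..<m])"
    unfolding block_def by (auto simp: sublist_Cons_right r)
  then show ?thesis
  proof cases
    case 3
    then have "sublist [y, x] [2..<m]" by (simp add: sublist_rev_right)
    then show ?thesis using sublist_upt by blast
  qed auto
qed

lemma sublist_in_set: "x \<in> set w \<Longrightarrow> sublist [x] w"
  by (auto dest!: split_list simp: sublist_def)

lemma sublist_concat_map:
  assumes "x \<in> set w"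
  shows "sublist (\<theta> x) (concat (map \<theta> w))"
proof -
  obtain u v where "w = u @ x # v" using assms by (meson split_list)
  then show ?thesis by simp
qed

lemma sublist_consecutive:
  assumes "1 \<le> i" "i < n"
  shows "sublist [i, Suc i] [1..<Suc n]"
proof -
  have "[1..<Suc n] = [1..<i] @ [i..<Suc n]"
    using assms upt_add_eq_append[of 1 i "Suc n - i"] by simp
  also have "[i..<Suc n] = [i, Suc i] @ [Suc (Suc i)..<Suc n]"
    using assms by (simp add: upt_conv_Cons del: upt_Suc)
  finally show ?thesis unfolding sublist_def by blast
qed

text \<open>
  A factor common to both blocks of \<open>chain_word m\<close> has length at most one, so every repeated
  letter is sent to a single letter. The first block then forces these letters to be
  consecutive, and the two adjacent extreme letters of the second block force \<open>n = m\<close>.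
\<close>

lemma chain_word_avoids:
  assumes n: "4 \<le> n" and m: "4 \<le> m"
    and ne: "\<And>x. x \<in> set (chain_word n) \<Longrightarrow> \<theta> x \<noteq> []"
    and sub: "sublist (concat (map \<theta> (chain_word n))) (chain_word m)"
  shows "n = m"
proof -
  define A where "A = [1..<Suc m]"
  define P where "P = concat (map \<theta> [1..<Suc n])"
  define Q where "Q = concat (map \<theta> (block n))"
  have blocks: "set (block n) = set [1..<Suc n]" "set (block m) = set A"
    using n m by (simp_all add: set_block A_def del: upt_Suc)
  then have PQ: "set Q = set P" by (simp add: P_def Q_def del: upt_Suc)
  have one: "1 \<in> set [1..<Suc n]" using n by (auto simp del: upt_Suc)
  then have "\<theta> 1 \<noteq> []" using ne by (simp add: chain_word_def del: upt_Suc)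
  then have P_ne: "set P \<noteq> {}" using one unfolding P_def set_concat set_map by fastforce
  have dist: "distinct A" "distinct (block m)" using m by (simp_all add: distinct_block A_def del: upt_Suc)
  have zero: "0 \<notin> set A" "0 \<notin> set (block m)" using blocks by (auto simp: A_def simp del: upt_Suc)
  have w: "chain_word m = A @ 0 # block m" by (simp add: chain_word_def A_def)
  obtain c d where eq: "A @ 0 # block m = c @ (P @ \<theta> 0 @ Q) @ d"
    using sub unfolding w sublist_def
    by (auto simp: chain_word_def P_def Q_def simp del: upt_Suc)
  note cut = append_Cons_eq_iff[OF zero]
  \<comment> \<open>The letter \<open>0\<close> occurs once in \<open>chain_word m\<close>, while
    every letter of \<open>P\<close> recurs in \<open>Q\<close>.\<close>
  have "count_list (c @ (P @ \<theta> 0 @ Q) @ d) 0 = 1"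
    unfolding eq[symmetric] using zero by (simp add: count_list_0_iff)
  then have PQ0: "0 \<notin> set P" "0 \<notin> set Q"
    using PQ count_list_0_iff[of P 0] count_list_0_iff[of Q 0] by auto
  \<comment> \<open>Otherwise the whole image lies inside one block, whose letters are distinct,
    although \<open>P\<close> and \<open>Q\<close> share letters.\<close>
  have "0 \<in> set (\<theta> 0)"
  proof (rule ccontr)
    assume "0 \<notin> set (\<theta> 0)"
    moreover have "0 \<in> set (c @ (P @ \<theta> 0 @ Q) @ d)" unfolding eq[symmetric] by simp
    ultimately consider "0 \<in> set c" | "0 \<in> set d" using PQ0 by auto
    then show False
    proof cases
      case 1
      then obtain c1 c2 where "c = c1 @ 0 # c2" by (meson split_list)
      then have "block m = c2 @ (P @ \<theta> 0 @ Q) @ d" using eq cut by simp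
      then show False using dist PQ P_ne by (auto simp: Int_Un_distrib)
    next
      case 2
      then obtain d1 d2 where "d = d1 @ 0 # d2" by (meson split_list)
      then have "A = c @ (P @ \<theta> 0 @ Q) @ d1"
        using eq cut[of "c @ (P @ \<theta> 0 @ Q) @ d1" d2] by simp
      then show False using dist PQ P_ne by (auto simp: Int_Un_distrib)
    qed
  qed
  then obtain g h where "\<theta> 0 = g @ 0 # h" by (meson split_list)
  then have "A = c @ P @ g" "block m = h @ Q @ d"
    using eq cut[of "c @ P @ g" "h @ Q @ d"] by simp_all
  then have subP: "sublist P A" and subQ: "sublist Q (block m)" by (auto simp: sublist_def)
  define f where "f i = hd (\<theta> i)" for i
  \<comment> \<open>The first two letters of a longer image would be neighbours in both blocks:
    consecutive and ascending in \<open>A\<close>, which \<open>block m\<close> excludes.\<close>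
  have letter: "\<theta> i = [f i]" if i: "i \<in> set [1..<Suc n]" for i
  proof (rule ccontr)
    assume "\<theta> i \<noteq> [f i]"
    moreover have "\<theta> i \<noteq> []" using i ne by (simp add: chain_word_def del: upt_Suc)
    ultimately obtain x y zs where xy: "\<theta> i = x # y # zs"
      unfolding f_def by (metis list.exhaust list.sel(1))
    have "sublist (\<theta> i) P" unfolding P_def by (rule sublist_concat_map) (rule i)
    then have "y = Suc x"
      using subP sublist_order.order_trans xy sublist_upt unfolding A_def by metis
    have "sublist (\<theta> i) Q" unfolding Q_def by (rule sublist_concat_map) (simp only: blocks i)
    then have "sublist ([x, y] @ zs) (block m)"
      using subQ sublist_order.order_trans xy by fastforce
    then have "sublist [x, y] (block m)" by (rule sublist_appendD)
    with \<open>y = Suc x\<close> show False using sublist_block[OF m, of x y] m by auto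
  qed
  have letters: "concat (map \<theta> u) = map f u" if "\<And>i. i \<in> set u \<Longrightarrow> \<theta> i = [f i]" for u
    using that by (induction u) simp_all
  have P: "P = map f [1..<Suc n]" unfolding P_def by (rule letters) (rule letter)
  have Q: "Q = map f (block n)"
    unfolding Q_def by (rule letters) (simp only: blocks letter)
  have step: "f (Suc i) = Suc (f i)" if "1 \<le> i" "i < n" for i
  proof -
    have "sublist [f i, f (Suc i)] P"
      unfolding P using map_mono_sublist[OF sublist_consecutive[OF that], of f] by simp
    then show ?thesis
      using subP sublist_order.order_trans sublist_upt unfolding A_def by metis
  qed
  have "f (Suc k) = f 1 + k" if "k < n" for k
    using that by (induction k) (simp_all add: step)
  from this[of "n - 1"] have fn: "f n = f 1 + (n - 1)" using n by simp
  have "sublist ([f n, f 1] @ map f (rev [2..<n])) (block m)"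
    using subQ unfolding Q by (simp add: block_def)
  then have "sublist [f n, f 1] (block m)" by (rule sublist_appendD)
  \<comment> \<open>Since \<open>f n\<close> exceeds \<open>f 1\<close> by \<open>n - 1\<close>,
    which is at least 3, only the pair \<open>m\<close>, \<open>1\<close> is possible, so
    \<open>n = m\<close>.\<close>
  then show ?thesis using sublist_block[OF m, of "f n" "f 1"] fn n m by auto
qed

lemma chain_word_nonempty [simp]: "chain_word n \<noteq> []"
  by (simp add: chain_word_def)

text \<open>For \<open>n \<noteq> m\<close> both sides are always zero. For \<open>n = m\<close>
  sending each letter to itself gives \<open>chain_word m\<close> on the left, while the longer word
  on the right is no factor and becomes zero.\<close>

lemma factor_semigroup_satisfies_chain_identity_iff:
  assumes "4 \<le> n" "4 \<le> m"
  shows "satisfies (factor_semigroup (chain_word m)) (chain_identity n) \<longleftrightarrow> n \<noteq> m"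
proof
  assume "n \<noteq> m"
  have "eval_term (factor_semigroup (chain_word m)) \<theta> (word_term (chain_word n @ v)) = []"
    if \<theta>: "range \<theta> \<subseteq> carrier (factor_semigroup (chain_word m))" for \<theta> v
    using chain_word_avoids[OF assms, of \<theta>] \<open>n \<noteq> m\<close>
      sublist_appendD(1)[of "concat (map \<theta> (chain_word n))" "concat (map \<theta> v)"]
    by (auto simp: eval_term_factor_semigroup[OF \<theta>])
  from this[of _ "[]"] this[of _ "[1]"]
  show "satisfies (factor_semigroup (chain_word m)) (chain_identity n)"
    by (simp add: satisfies_def chain_identity_def)
next
  let ?w = "chain_word m"
  assume sat: "satisfies (factor_semigroup ?w) (chain_identity n)"
  show "n \<noteq> m"
  proof
    assume "n = m"
    \<comment> \<open>Letters outside the word go to the zero so that all values lie in the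
      carrier.\<close>
    define \<theta> where "\<theta> x = (if x \<in> set ?w then [x] else [])" for x
    have \<theta>: "range \<theta> \<subseteq> carrier (factor_semigroup ?w)"
      by (auto simp: \<theta>_def factor_semigroup_def sublist_in_set)
    have "map \<theta> ?w = map (\<lambda>x. [x]) ?w" by (auto simp: \<theta>_def)
    then have "concat (map \<theta> ?w) = ?w" by (simp only: concat_map_singleton) simp
    then have "eval_term (factor_semigroup ?w) \<theta> (word_term ?w) = ?w"
      by (simp add: eval_term_factor_semigroup[OF \<theta>] \<theta>_def)
    moreover have "eval_term (factor_semigroup ?w) \<theta> (word_term (?w @ [1])) \<noteq> ?w"
      using \<open>concat (map \<theta> ?w) = ?w\<close>
      by (auto simp: eval_term_factor_semigroup[OF \<theta>] dest: sym[of "[]"])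
    ultimately show False
      using sat \<theta> \<open>n = m\<close> by (auto simp: satisfies_def chain_identity_def)
  qed
qed

section \<open>The interval\<close>

lemma s7_times_one [simp]: "s7_times x S7_one = x"
  by (cases x) simp_all

lemma s7_times_assoc: "s7_times (s7_times x y) z = s7_times x (s7_times y z)"
  by (cases x; cases y; cases z) simp_all

lemma is_semigroup_S7: "is_semigroup S7_reduct"
  by (simp add: is_semigroup_def S7_reduct_def s7_times_assoc)

lemma UNIV_s7: "UNIV = {S7_zero, S7_a, S7_one}"
  using s7.exhaust by blast

lemma eval_word_term_S7:
  "w \<noteq> [] \<Longrightarrow> eval_term S7_reduct \<phi> (word_term w) = foldr (\<lambda>x. s7_times (\<phi> x)) w S7_one"
  by (induction w rule: word_term.induct) (auto simp: S7_reduct_def)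

text \<open>The letter \<open>1\<close> already occurs twice in \<open>chain_word n\<close>. If its
  value is the identity, a further occurrence changes nothing; otherwise both sides are zero, since
  any two elements other than the identity multiply to zero.\<close>

lemma S7_satisfies_chain_identity:
  assumes "1 \<le> n"
  shows "satisfies S7_reduct (chain_identity n)"
  unfolding satisfies_def
proof (intro allI impI)
  fix \<phi> :: "nat \<Rightarrow> s7"
  define E where "E w = foldr (\<lambda>x. s7_times (\<phi> x)) w S7_one" for w
  have E: "E [] = S7_one" "E (x # w) = s7_times (\<phi> x) (E w)" for x w
    by (simp_all add: E_def)
  have append: "E (u @ v) = s7_times (E u) (E v)" for u v
    by (induction u) (simp_all add: E s7_times_assoc)
  define U where "U = [2..<Suc n] @ [0, n]"
  define V where "V = rev [2..<n]"
  have w: "chain_word n = 1 # U @ 1 # V"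
    using assms upt_conv_Cons[of 1 "Suc n"]
    by (simp add: chain_word_def block_def U_def V_def numeral_2_eq_2 del: upt_Suc)
  have "E (chain_word n) = E (chain_word n @ [1])"
    by (cases "\<phi> 1"; cases "E U"; cases "E V") (simp_all add: w append E)
  then show "eval_term S7_reduct \<phi> (fst (chain_identity n)) =
      eval_term S7_reduct \<phi> (snd (chain_identity n))"
    by (simp add: chain_identity_def eval_word_term_S7 E_def)
qed

lemma B21_identities_subset_S7: "identities B21_reduct \<subseteq> identities S7_reduct"
proof -
  define h where "h x = (case x of S7_zero \<Rightarrow> mat2 0 0 0 0 | S7_a \<Rightarrow> mat2 0 1 0 0
      | S7_one \<Rightarrow> mat2 1 0 0 1)" for x
  have "inj h" by (auto simp: inj_def h_def split: s7.splits)
  moreover have "range h \<subseteq> B21" by (auto simp: h_def split: s7.splits)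
  moreover have "h (s7_times x y) = h x ** h y" for x y
    by (cases x; cases y) (simp_all add: h_def)
  ultimately have "satisfies S7_reduct e" if "satisfies B21_reduct e" for e
    using that by (intro satisfies_embedding[OF is_semigroup_S7, of h B21_reduct])
      (auto simp: S7_reduct_def)
  then show ?thesis by (auto simp: identities_def)
qed

theorem theorem1p2:
  assumes "infinite (UNIV :: 'u set)"
  shows "(variety_interval (variety_generated_by S7_reduct) (variety_generated_by B21_reduct)
            :: 'u magma set set) \<approx> (UNIV :: nat set set)"
proof (rule lepoll_antisym)
  let ?I = "variety_interval (variety_generated_by S7_reduct) (variety_generated_by B21_reduct)
              :: 'u magma set set"
  have "?I \<subseteq> {V. semigroup_variety V}" by (auto simp: variety_interval_def)
  then show "?I \<lesssim> (UNIV :: nat set set)"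
    using semigroup_varieties_lepoll subset_imp_lepoll lepoll_trans by blast
  have S7: "(variety_generated_by S7_reduct :: 'u magma set) = models (identities S7_reduct)"
    by (rule variety_generated_by_eq_models[OF assms is_semigroup_S7])
      (simp add: S7_reduct_def UNIV_s7)
  have B21: "(variety_generated_by B21_reduct :: 'u magma set) = models (identities B21_reduct)"
    by (rule variety_generated_by_eq_models[OF assms is_semigroup_B21])
      (simp add: B21_reduct_def)
  \<comment> \<open>The shift keeps to the indices from 4 on, where the identities are
    independent.\<close>
  define ident where "ident k = chain_identity (k + 4)" for k
  define V :: "nat set \<Rightarrow> 'u magma set" where
    "V N = models (identities B21_reduct \<union> ident ` N)" for N
  have "V N \<in> ?I" for N
  proof -
    have "identities B21_reduct \<union> ident ` N \<subseteq> identities S7_reduct"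
      using B21_identities_subset_S7 S7_satisfies_chain_identity
      by (auto simp: ident_def identities_def)
    then have "models (identities S7_reduct) \<subseteq> V N" unfolding V_def models_def by blast
    moreover have "V N \<subseteq> models (identities B21_reduct)" unfolding V_def models_def by blast
    moreover have "semigroup_variety (V N)" unfolding semigroup_variety_def V_def models_def by blast
    ultimately show ?thesis by (simp add: variety_interval_def S7 B21)
  qed
  moreover have "inj V"
  proof -
    \<comment> \<open>The set \<open>N\<close> is recovered from \<open>V N\<close> as the set of
      indices of the identities valid throughout \<open>V N\<close>.\<close>
    have "m \<in> N \<longleftrightarrow> (\<forall>T\<in>V N. satisfies T (ident m))" for m N
    proof
      assume sat: "\<forall>T\<in>V N. satisfies T (ident m)"
      let ?F = "factor_semigroup (chain_word (m + 4))"
      note F = is_semigroup_factor_semigroup[of "chain_word (m + 4)"]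
      \<comment> \<open>The factor semigroup lives on lists, so a copy in the universe serves as the
        separating member.\<close>
      obtain T :: "'u magma" where T: "isomorphic ?F T"
        using isomorphic_copy_exists[OF assms, of ?F] by auto
      note iff = isomorphic_satisfies_iff[OF F T]
      have "\<not> satisfies T (ident m)"
        by (simp add: ident_def factor_semigroup_satisfies_chain_identity_iff flip: iff)
      then have notin: "T \<notin> V N" using sat by blast
      have "satisfies T e" if "e \<in> identities B21_reduct" for e
        using that factor_semigroup_satisfies_B21_identities[OF isoterm_chain_word, of "m + 4" e]
        by (simp add: identities_def flip: iff)
      moreover have "satisfies T (ident k)" if "k \<noteq> m" for k
        using that by (simp add: ident_def factor_semigroup_satisfies_chain_identity_iff flip: iff)
      ultimately have "T \<in> V N" if "m \<notin> N"
        unfolding V_def models_def using isomorphic_is_semigroup[OF F T] that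
        by (intro CollectI conjI ballI) (assumption, elim UnE imageE, blast, metis)
      then show "m \<in> N" using notin by blast
    qed (simp add: V_def models_def)
    then show ?thesis by (metis injI subset_antisym subsetI)
  qed
  ultimately show "(UNIV :: nat set set) \<lesssim> ?I"
    unfolding lepoll_def by blast
qed

end
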